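(* Let $X$ be an $\mathcal A(f)$-set. Then $\mathcal A(f)[X]$ is the smallest element of $\mathcal A(f)$ containing $X$, with respect to inclusion.
   Context: Notation: $\mathbb N=\{0,1,2,\dots\}$, $p\ge 1$, and $\Lambda=\{e_1,\dots,e_p\}$ is the canonical basis of $\mathbb N^p$. $\mathcal C\subseteq\mathbb N^p$ is a fixed non-negative integer cone (the set of points of $\mathbb N^p$ lying in a finitely generated rational convex cone), with at least $p$ extremal rays. A $\mathcal C$-semigroup is a finitely generated submonoid $S\subseteq\mathcal C$ of $\mathbb N^p$ such that the minimal integer cone containing $S$ is $\mathcal C$ and $\mathcal H(S)=\mathcal C\setminus S$ is finite. A monomial order $\preceq$ on $\mathbb N^p$ is fixed: a total order compatible with addition with $0\preceq x$ for all $x$; it is assumed that $\{x\in\mathcal C\mid x\preceq k\}$ is finite for every $k\in\mathcal C$. $\operatorname{Fb}(S)=\max_\preceq\mathcal H(S)$ (and $-\sum_i e_i$ if $\mathcal H(S)=\emptyset$), $\operatorname{N}(S)=\{x\in S\mid x\prec\operatorname{Fb}(S)\}$. A $\mathcal C$-semigroup $S$ is an $\mathcal A$-semigroup if for every $s\in S$ and $e\in\Lambda$ the set $\{s,s+e\}$ is not contained in $\operatorname{N}(S)$. An element $f\in\mathcal C\setminus\{0\}$ is fixed; $\mathcal A(f)$ is the set of all $\mathcal A$-semigroups $S$ with $\operatorname{Fb}(S)=f$, and $\Delta(f)=\{0\}\cup\{x\in\mathcal C\mid x\succ f\}$. A set $X$ is an $\mathcal A(f)$-set if $X\cap\Delta(f)=\emptyset$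 and there is $S\in\mathcal A(f)$ with $X\subset S$. For an $\mathcal A(f)$-set $X$, $\mathcal A(f)[X]$ is the intersection of all elements of $\mathcal A(f)$ containing $X$. *)

theory Defs
  imports "HOL-Analysis.Analysis"
begin

text \<open>
  The monoid of \<open>p\<close>-tuples of natural numbers is the type \<open>nat ^ 'p\<close> with \<open>p = CARD('p) \<ge> 1\<close>; its
  canonical basis consists of the vectors \<open>axis i 1\<close>.  The library's order \<open>\<le>\<close> on \<open>nat ^ 'p\<close> is
  the componentwise one; it plays no role here, monomial orders are separate relations.
\<close>

definition nvec :: "nat ^ 'p \<Rightarrow> 'b::semiring_1 ^ 'p" where
  "nvec x = (\<chi> i. of_nat (x $ i))"

definition integer_cone :: "(nat ^ 'p) set \<Rightarrow> bool" where
  "integer_cone C \<longleftrightarrow>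
     (\<exists>V :: (real ^ 'p) set. finite V \<and> (\<forall>v\<in>V. \<forall>i. v $ i \<in> \<rat>) \<and>
        C = {x. nvec x \<in> convex_cone hull V})"

definition extremal_rays :: "'b::real_vector set \<Rightarrow> 'b set set" where
  "extremal_rays K = {R. R face_of K \<and> (\<exists>v. v \<noteq> 0 \<and> R = {t *\<^sub>R v |t. 0 \<le> t})}"

text \<open>
  The extremal rays of an integer cone are those of the real cone it spans.  This real cone lies in
  the non-negative orthant also when the rational cone cutting out \<open>C\<close> does not.
\<close>

definition cone_rays :: "(nat ^ 'p) set \<Rightarrow> (real ^ 'p) set set" where
  "cone_rays C = extremal_rays (convex_cone hull (nvec ` C))"

definition minimal_integer_cone :: "(nat ^ 'p) set \<Rightarrow> (nat ^ 'p) set \<Rightarrow> bool" where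
  "minimal_integer_cone S C \<longleftrightarrow>
     integer_cone C \<and> S \<subseteq> C \<and> (\<forall>D. integer_cone D \<and> S \<subseteq> D \<longrightarrow> C \<subseteq> D)"

definition add_submonoid :: "'b::monoid_add set \<Rightarrow> bool" where
  "add_submonoid S \<longleftrightarrow> 0 \<in> S \<and> (\<forall>x\<in>S. \<forall>y\<in>S. x + y \<in> S)"

definition fin_gen_submonoid :: "'b::monoid_add set \<Rightarrow> bool" where
  "fin_gen_submonoid S \<longleftrightarrow> (\<exists>G. finite G \<and> S = add_submonoid hull G)"

definition gaps :: "(nat ^ 'p) set \<Rightarrow> (nat ^ 'p) set \<Rightarrow> (nat ^ 'p) set" where
  "gaps C S = C - S"

definition C_semigroup :: "(nat ^ 'p) set \<Rightarrow> (nat ^ 'p) set \<Rightarrow> bool" where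
  "C_semigroup C S \<longleftrightarrow>
     fin_gen_submonoid S \<and> S \<subseteq> C \<and> minimal_integer_cone S C \<and> finite (gaps C S)"

definition monomial_order :: "(nat ^ 'p \<Rightarrow> nat ^ 'p \<Rightarrow> bool) \<Rightarrow> bool" where
  "monomial_order le \<longleftrightarrow>
     linear_order {(x, y). le x y} \<and>
     (\<forall>x y z. le x y \<longrightarrow> le (x + z) (y + z)) \<and>
     (\<forall>x. le 0 x)"

text \<open>
  The Frobenius element lives in \<open>int ^ 'p\<close>, because by convention it is the vector \<open>(-1, \<dots>, -1)\<close>
  when there are no gaps.
\<close>

definition Fb :: "(nat ^ 'p \<Rightarrow> nat ^ 'p \<Rightarrow> bool) \<Rightarrow> (nat ^ 'p) set \<Rightarrow> (nat ^ 'p) set \<Rightarrow> int ^ 'p" where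
  "Fb le C S =
     (if gaps C S = {} then - (\<Sum>i\<in>UNIV. axis i 1)
      else nvec (THE m. m \<in> gaps C S \<and> (\<forall>x\<in>gaps C S. le x m)))"

text \<open>
  No element of \<open>nat ^ 'p\<close> precedes \<open>(-1, \<dots>, -1)\<close>, so the set below is empty if there are no gaps.
\<close>

definition small_elements ::
    "(nat ^ 'p \<Rightarrow> nat ^ 'p \<Rightarrow> bool) \<Rightarrow> (nat ^ 'p) set \<Rightarrow> (nat ^ 'p) set \<Rightarrow> (nat ^ 'p) set" where
  "small_elements le C S = {x \<in> S. \<exists>h. Fb le C S = nvec h \<and> le x h \<and> x \<noteq> h}"

definition A_semigroup ::
    "(nat ^ 'p \<Rightarrow> nat ^ 'p \<Rightarrow> bool) \<Rightarrow> (nat ^ 'p) set \<Rightarrow> (nat ^ 'p) set \<Rightarrow> bool" where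
  "A_semigroup le C S \<longleftrightarrow>
     C_semigroup C S \<and> (\<forall>s\<in>S. \<forall>i. \<not> {s, s + axis i 1} \<subseteq> small_elements le C S)"

definition A_semigroups ::
    "(nat ^ 'p \<Rightarrow> nat ^ 'p \<Rightarrow> bool) \<Rightarrow> (nat ^ 'p) set \<Rightarrow> nat ^ 'p \<Rightarrow> (nat ^ 'p) set set" where
  "A_semigroups le C f = {S. A_semigroup le C S \<and> Fb le C S = nvec f}"

definition Delta ::
    "(nat ^ 'p \<Rightarrow> nat ^ 'p \<Rightarrow> bool) \<Rightarrow> (nat ^ 'p) set \<Rightarrow> nat ^ 'p \<Rightarrow> (nat ^ 'p) set" where
  "Delta le C f = {0} \<union> {x \<in> C. le f x \<and> x \<noteq> f}"

definition A_set ::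
    "(nat ^ 'p \<Rightarrow> nat ^ 'p \<Rightarrow> bool) \<Rightarrow> (nat ^ 'p) set \<Rightarrow> nat ^ 'p \<Rightarrow> (nat ^ 'p) set \<Rightarrow> bool" where
  "A_set le C f X \<longleftrightarrow> X \<inter> Delta le C f = {} \<and> (\<exists>S\<in>A_semigroups le C f. X \<subseteq> S)"

definition A_generated ::
    "(nat ^ 'p \<Rightarrow> nat ^ 'p \<Rightarrow> bool) \<Rightarrow> (nat ^ 'p) set \<Rightarrow> nat ^ 'p \<Rightarrow> (nat ^ 'p) set \<Rightarrow> (nat ^ 'p) set"
  where "A_generated le C f X = \<Inter> {S \<in> A_semigroups le C f. X \<subseteq> S}"

end

theory Submission
  imports Defs
begin

text \<open>
  Because the order is total and every member of \<open>\<A>(f)\<close> has finitely many gaps, \<open>Fb(S) = f\<close>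
  says that \<open>f\<close> is a gap of \<open>S\<close> and that every gap of \<open>S\<close> is at most \<open>f\<close> (lemma \<open>Fb_eq_iff\<close>).
  This condition passes to the intersection \<open>T\<close> of any nonempty family of members of \<open>\<A>(f)\<close>,
  since a gap of \<open>T\<close> is a gap of some member. Hence the gaps of \<open>T\<close> lie in
  \<open>{x \<in> C. x \<preceq> f}\<close>, which is finite by the assumption on the order, although the family itself
  may be infinite. The intersection has the same Frobenius element as each member \<open>S\<close>, so the small
  elements of \<open>T\<close> are small in \<open>S\<close>, and the condition on \<open>{s, s + e}\<close> is inherited.

  That \<open>T\<close> is a \<open>\<C>\<close>-semigroup depends only on its being a submonoid that misses finitely many points
  of \<open>C\<close>. It spans the whole cone, as each point of \<open>C\<close> has a positive multiple in
  \<open>T\<close> (lemma \<open>minimal_integer_cone_cofinite\<close>). It is finitely generated, as it is cofinite in any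
  one of the finitely generated monoids \<open>S\<close> of the family (lemma
  \<open>fin_gen_submonoid_cofinite\<close>); comparing with \<open>S\<close> instead of \<open>C\<close> avoids Gordan's lemma on
  the finite generation of \<open>C\<close>.
\<close>

section \<open>Finite generation of cofinite submonoids\<close>

definition total_degree :: "nat ^ 'p \<Rightarrow> nat" where
  "total_degree x = (\<Sum>i\<in>UNIV. x $ i)"

lemma total_degree_zero [simp]: "total_degree 0 = 0"
  by (simp add: total_degree_def)

lemma total_degree_add [simp]: "total_degree (x + y) = total_degree x + total_degree y"
  by (simp add: total_degree_def sum.distrib)

lemma finite_total_degree_le: "finite {x :: nat ^ 'p. total_degree x \<le> d}"
proof (rule finite_subset)
  show "{x :: nat ^ 'p. total_degree x \<le> d} \<subseteq> {x. \<forall>i. x $ i \<in> {..d}}"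
  proof (intro subsetI CollectI allI)
    fix x :: "nat ^ 'p" and i
    assume "x \<in> {x. total_degree x \<le> d}"
    then have "total_degree x \<le> d" by simp
    moreover have "x $ i \<le> total_degree x"
      unfolding total_degree_def by (rule member_le_sum) auto
    ultimately show "x $ i \<in> {..d}" by simp
  qed
  have "finite ((\<lambda>h. \<chi> i. h i) ` (PiE (UNIV :: 'p set) (\<lambda>_. {..d})))"
    by (intro finite_imageI finite_PiE) auto
  moreover have "{x :: nat ^ 'p. \<forall>i. x $ i \<in> {..d}}
      \<subseteq> (\<lambda>h. \<chi> i. h i) ` (PiE (UNIV :: 'p set) (\<lambda>_. {..d}))"
  proof
    fix x :: "nat ^ 'p"
    assume "x \<in> {x. \<forall>i. x $ i \<in> {..d}}"
    then have "(\<lambda>i. x $ i) \<in> PiE UNIV (\<lambda>_. {..d})" by auto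
    moreover have "x = (\<chi> i. x $ i)" by simp
    ultimately show "x \<in> (\<lambda>h. \<chi> i. h i) ` (PiE UNIV (\<lambda>_. {..d}))" by blast
  qed
  ultimately show "finite {x :: nat ^ 'p. \<forall>i. x $ i \<in> {..d}}"
    by (rule rev_finite_subset)
qed

lemma add_submonoid_hull: "add_submonoid (add_submonoid hull G)"
  by (rule hull_in) (auto simp: add_submonoid_def)

text \<open>
  Adding up the generators of \<open>s\<close> one at a time, the degree of the partial sum grows by at most
  \<open>M\<close> in each step, so it cannot jump over an interval of length \<open>M\<close>.
  As an induction over the hull: the elements that can be split at every degree form a submonoid.
\<close>

lemma hull_decomposition_degree:
  fixes G :: "(nat ^ 'p) set"
  assumes G: "\<And>g. g \<in> G \<Longrightarrow> total_degree g \<le> M"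
    and "s \<in> add_submonoid hull G" "d \<le> total_degree s"
  obtains a b where "a \<in> add_submonoid hull G" "b \<in> add_submonoid hull G" "s = a + b"
    "d \<le> total_degree a" "total_degree a \<le> d + M"
proof -
  define S where "S = add_submonoid hull G"
  have S: "0 \<in> S" "\<And>x y. x \<in> S \<Longrightarrow> y \<in> S \<Longrightarrow> x + y \<in> S"
    using add_submonoid_hull[of G] by (auto simp: S_def add_submonoid_def)
  define P where "P = {s \<in> S. \<forall>d \<le> total_degree s. \<exists>a\<in>S. \<exists>b\<in>S. s = a + b \<and>
    d \<le> total_degree a \<and> total_degree a \<le> d + M}"
  have "S \<subseteq> P"
    unfolding S_def
  proof (rule hull_minimal)
    show "G \<subseteq> P"
    proof
      fix g assume g: "g \<in> G"
      then have "g \<in> S" by (simp add: S_def hull_inc)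
      moreover have "g = g + 0" "\<And>d. total_degree g \<le> d + M"
        using G[OF g] by (auto intro: trans_le_add2)
      ultimately show "g \<in> P" unfolding P_def using S(1) by blast
    qed
    have "x + y \<in> P" if "x \<in> P" "y \<in> P" for x y
    proof -
      have xy: "x \<in> S" "y \<in> S" using that by (auto simp: P_def)
      have "\<exists>a\<in>S. \<exists>b\<in>S. x + y = a + b \<and> d \<le> total_degree a \<and> total_degree a \<le> d + M"
        if d: "d \<le> total_degree (x + y)" for d
      proof (cases "d \<le> total_degree x")
        case True
        then obtain a b where "a \<in> S" "b \<in> S" "x = a + b" "d \<le> total_degree a"
          "total_degree a \<le> d + M"
          using \<open>x \<in> P\<close> unfolding P_def by blast
        then show ?thesis using xy S(2)
          by (intro bexI[of _ a] bexI[of _ "b + y"]) (auto simp: add.assoc)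
      next
        case False
        then have "d - total_degree x \<le> total_degree y" using d by simp
        then obtain a b where "a \<in> S" "b \<in> S" "y = a + b" "d - total_degree x \<le> total_degree a"
          "total_degree a \<le> d - total_degree x + M"
          using \<open>y \<in> P\<close> unfolding P_def by blast
        then show ?thesis using xy S(2) False
          by (intro bexI[of _ "x + a"] bexI[of _ b]) (auto simp: add.assoc)
      qed
      then show ?thesis using S(2) xy by (simp add: P_def)
    qed
    moreover have "0 \<in> P" using S(1) by (force simp: P_def)
    ultimately show "add_submonoid P" by (simp add: add_submonoid_def)
  qed
  then show thesis using assms(2,3) that unfolding P_def S_def by blast
qed

text \<open>
  Let \<open>M\<close> bound the degrees of the generators of \<open>S\<close> and of the missing points \<open>S - T\<close>. An element
  of \<open>T\<close> of large degree splits in \<open>S\<close> as \<open>a + b\<close> with both degrees above \<open>M\<close>, so both summands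
  lie in \<open>T\<close>. Thus \<open>T\<close> is generated by its elements of small degree.
\<close>

lemma fin_gen_submonoid_cofinite:
  fixes S T :: "(nat ^ 'p) set"
  assumes "fin_gen_submonoid S" and T: "add_submonoid T" and "T \<subseteq> S" and "finite (S - T)"
  shows "fin_gen_submonoid T"
proof -
  obtain G where G: "finite G" "S = add_submonoid hull G"
    using assms(1) by (auto simp: fin_gen_submonoid_def)
  have "finite (total_degree ` (G \<union> (S - T)))" using G(1) assms(4) by simp
  then obtain M where "\<forall>n \<in> total_degree ` (G \<union> (S - T)). n \<le> M"
    by (meson finite_nat_set_iff_bounded_le)
  then have MG: "\<And>g. g \<in> G \<Longrightarrow> total_degree g \<le> M"
    and MF: "\<And>x. x \<in> S \<Longrightarrow> M < total_degree x \<Longrightarrow> x \<in> T" by force+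
  \<comment> \<open>If \<open>a\<close> is split off with degree between \<open>M + 1\<close> and \<open>2 * M + 1\<close>, the rest of an element of
    degree above \<open>3 * M + 1\<close> has degree above \<open>M\<close>; the summand \<open>a\<close> is itself in \<open>Y\<close>.\<close>
  define Y where "Y = {t \<in> T. total_degree t \<le> 3 * M + 1}"
  have hY: "x + y \<in> add_submonoid hull Y"
    if "x \<in> add_submonoid hull Y" "y \<in> add_submonoid hull Y" for x y
    using that add_submonoid_hull[of Y] by (simp add: add_submonoid_def)
  have "t \<in> add_submonoid hull Y" if "t \<in> T" for t
    using that
  proof (induction t rule: measure_induct_rule[of total_degree])
    case (less t)
    show ?case
    proof (cases "total_degree t \<le> 3 * M + 1")
      case True
      then show ?thesis using less.prems by (simp add: Y_def hull_inc)
    next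
      case False
      have "t \<in> add_submonoid hull G" "M + 1 \<le> total_degree t"
        using less.prems assms(3) G(2) False by auto
      then obtain a b where ab: "a \<in> S" "b \<in> S" "t = a + b" "M + 1 \<le> total_degree a"
        "total_degree a \<le> M + 1 + M"
        using hull_decomposition_degree[OF MG] G(2) by blast
      then have "a \<in> T" "b \<in> T" using False by (auto intro: MF)
      then have "a \<in> add_submonoid hull Y" "b \<in> add_submonoid hull Y"
        using ab less.IH by (auto simp: Y_def intro: hull_inc)
      then show ?thesis using hY ab(3) by simp
    qed
  qed
  moreover have "add_submonoid hull Y \<subseteq> T"
    by (rule hull_minimal) (auto simp: Y_def T)
  moreover have "finite Y"
    using finite_total_degree_le by (rule rev_finite_subset) (auto simp: Y_def)
  ultimately show ?thesis unfolding fin_gen_submonoid_def by blast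
qed

section \<open>The cone spanned by a cofinite submonoid\<close>

lemma integer_cone_scale_iff:
  assumes "integer_cone D" "0 < n"
  shows "(\<chi> i. n * x $ i) \<in> D \<longleftrightarrow> x \<in> D"
proof -
  obtain V :: "(real ^ 'a) set" where V: "D = {x. nvec x \<in> convex_cone hull V}"
    using assms(1) by (auto simp: integer_cone_def)
  have cc: "c *\<^sub>R v \<in> convex_cone hull V" if "v \<in> convex_cone hull V" "0 \<le> c" for c v
    using that convex_cone_convex_cone_hull[of V] by (simp add: convex_cone_def conic_def)
  have eq: "nvec (\<chi> i. n * x $ i) = real n *\<^sub>R (nvec x :: real ^ 'a)"
    by (simp add: nvec_def vec_eq_iff)
  have "nvec x \<in> convex_cone hull V" if "real n *\<^sub>R nvec x \<in> convex_cone hull V"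
    using cc[OF that, of "1 / real n"] assms(2) by simp
  then show ?thesis using cc[of "nvec x" "real n"] by (auto simp: V eq)
qed

text \<open>
  The multiples of a nonzero point of \<open>C\<close> are infinitely many points of \<open>C\<close>, so one of them is in
  \<open>T\<close>, hence in every integer cone around \<open>T\<close>; and an integer cone contains a point as soon as it
  contains a positive multiple of it.
\<close>

lemma minimal_integer_cone_cofinite:
  assumes C: "integer_cone C" and T: "T \<subseteq> C" "0 \<in> T" "finite (C - T)"
  shows "minimal_integer_cone T C"
  unfolding minimal_integer_cone_def
proof (intro conjI allI impI C T(1))
  fix D assume D: "integer_cone D \<and> T \<subseteq> D"
  show "C \<subseteq> D"
  proof
    fix x assume x: "x \<in> C"
    show "x \<in> D"
    proof (cases "x = 0")
      case True
      then show ?thesis using D T(2) by auto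
    next
      case False
      then obtain j where "x $ j \<noteq> 0" by (auto simp: vec_eq_iff)
      then have "inj (\<lambda>n. \<chi> i. n * x $ i)"
        by (auto simp: inj_def vec_eq_iff dest!: spec[of _ j])
      then have "infinite ((\<lambda>n. \<chi> i. n * x $ i) ` {0<..})"
        by (metis finite_imageD infinite_Ioi inj_on_subset subset_UNIV)
      then obtain n where n: "0 < n" "(\<chi> i. n * x $ i) \<notin> C - T"
        using T(3) by (metis (no_types, lifting) finite_subset greaterThan_iff image_subsetI)
      then have "(\<chi> i. n * x $ i) \<in> D"
        using D integer_cone_scale_iff[OF C n(1)] x by blast
      then show ?thesis using D integer_cone_scale_iff n(1) by blast
    qed
  qed
qed

section \<open>Frobenius elements\<close>

lemma nvec_int_eq_iff [simp]: "(nvec x :: int ^ 'p) = nvec y \<longleftrightarrow> x = y"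
  by (simp add: nvec_def vec_eq_iff)

lemma nvec_neq_minus_ones: "(nvec f :: int ^ 'p) \<noteq> - (\<Sum>i\<in>UNIV. axis i 1)"
proof
  assume "(nvec f :: int ^ 'p) = - (\<Sum>i\<in>UNIV. axis i 1)"
  then have "\<And>j. int (f $ j) = - (\<Sum>i\<in>UNIV. if i = j then 1 else 0)"
    by (auto simp: nvec_def vec_eq_iff axis_def eq_commute)
  then show False by simp
qed

lemma finite_linear_order_max:
  assumes "linear_order {(x, y). le x y}" "finite A" "A \<noteq> {}"
  obtains m where "m \<in> A" "\<And>x. x \<in> A \<Longrightarrow> le x m"
proof -
  have lin: "refl {(x, y). le x y}" "trans {(x, y). le x y}" "total {(x, y). le x y}"
    using assms(1) by (auto simp: order_on_defs)
  have refl: "le x x" for x using reflD[OF lin(1), of x] by simp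
  have tr: "le x y \<Longrightarrow> le y z \<Longrightarrow> le x z" for x y z using transD[OF lin(2), of x y z] by simp
  have tot: "le x y \<or> le y x" for x y
    using lin(3) refl by (cases "x = y") (auto simp: total_on_def)
  have "\<exists>m\<in>A. \<forall>x\<in>A. le x m"
    using assms(2,3)
  proof (induction A rule: finite_ne_induct)
    case (singleton x)
    then show ?case using refl by simp
  next
    case (insert x F)
    then obtain m where m: "m \<in> F" "\<forall>y\<in>F. le y m" by blast
    show ?case
    proof (cases "le x m")
      case True
      then show ?thesis using m by blast
    next
      case False
      then have "le m x" using tot by blast
      then show ?thesis using m tr refl by blast
    qed
  qed
  then show thesis using that by blast
qed

lemma Fb_eq_iff:
  assumes "monomial_order le" "finite (gaps C S)"
  shows "Fb le C S = nvec f \<longleftrightarrow> f \<in> gaps C S \<and> (\<forall>x\<in>gaps C S. le x f)"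
proof (cases "gaps C S = {}")
  case True
  then show ?thesis
    using nvec_neq_minus_ones[of f] by (simp add: Fb_def eq_commute)
next
  case False
  have lin: "linear_order {(x, y). le x y}" using assms(1) by (simp add: monomial_order_def)
  then have anti: "\<And>x y. le x y \<Longrightarrow> le y x \<Longrightarrow> x = y"
    by (auto simp: order_on_defs antisym_def)
  obtain m where m: "m \<in> gaps C S" "\<And>x. x \<in> gaps C S \<Longrightarrow> le x m"
    using finite_linear_order_max[OF lin assms(2) False] by blast
  then have "(THE m. m \<in> gaps C S \<and> (\<forall>x\<in>gaps C S. le x m)) = m"
    using anti by (intro the_equality) blast+
  then have "Fb le C S = nvec m" using False by (simp add: Fb_def)
  then show ?thesis using m anti by auto
qed

section \<open>Intersections of members of \<open>\<A>(f)\<close>\<close>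

lemma A_semigroupsD:
  assumes "monomial_order le" "S \<in> A_semigroups le C f"
  shows "fin_gen_submonoid S" "add_submonoid S" "S \<subseteq> C" "f \<in> gaps C S"
    "\<And>x. x \<in> gaps C S \<Longrightarrow> le x f" "Fb le C S = nvec f"
proof -
  have S: "C_semigroup C S" and Fb: "Fb le C S = nvec f"
    using assms(2) by (auto simp: A_semigroups_def A_semigroup_def)
  from S show "fin_gen_submonoid S" "S \<subseteq> C" by (auto simp: C_semigroup_def)
  then show "add_submonoid S" using add_submonoid_hull by (auto simp: fin_gen_submonoid_def)
  show "Fb le C S = nvec f" by (fact Fb)
  have "finite (gaps C S)" using S by (simp add: C_semigroup_def)
  then show "f \<in> gaps C S" "\<And>x. x \<in> gaps C S \<Longrightarrow> le x f"
    using Fb Fb_eq_iff[OF assms(1)] by blast+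
qed

lemma Inter_A_semigroups:
  assumes C: "integer_cone C" and le: "monomial_order le"
    and fin: "finite {x \<in> C. le x f}"
    and \<S>: "\<S> \<subseteq> A_semigroups le C f" "\<S> \<noteq> {}"
  shows "\<Inter>\<S> \<in> A_semigroups le C f"
proof -
  obtain S where S: "S \<in> \<S>" using \<S>(2) by blast
  then have SA: "S \<in> A_semigroups le C f" using \<S>(1) by blast
  note D = A_semigroupsD[OF le subsetD[OF \<S>(1)]]
  define T where "T = \<Inter>\<S>"
  have TS: "T \<subseteq> S" using S by (auto simp: T_def)
  then have TC: "T \<subseteq> C" using D(3)[OF S] by blast
  have T: "add_submonoid T" using D(2) by (auto simp: T_def add_submonoid_def)
  have gapsT: "le x f" if "x \<in> gaps C T" for x
  proof -
    from that obtain S' where "S' \<in> \<S>" "x \<in> gaps C S'" by (auto simp: T_def gaps_def)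
    then show ?thesis by (rule D(5))
  qed
  have finT: "finite (gaps C T)"
    by (rule finite_subset[OF _ fin]) (use gapsT in \<open>auto simp: gaps_def\<close>)
  have "f \<in> gaps C T" using D(4)[OF S] TS by (auto simp: gaps_def)
  then have Fb: "Fb le C T = nvec f" using Fb_eq_iff[OF le finT] gapsT by blast
  have "finite (S - T)"
    by (rule finite_subset[OF _ finT]) (use D(3)[OF S] in \<open>auto simp: gaps_def\<close>)
  then have "fin_gen_submonoid T"
    by (rule fin_gen_submonoid_cofinite[OF D(1)[OF S] T TS])
  moreover have "minimal_integer_cone T C"
    using minimal_integer_cone_cofinite[OF C TC] T finT
    by (simp add: add_submonoid_def gaps_def)
  ultimately have "C_semigroup C T" using TC finT by (simp add: C_semigroup_def)
  moreover have "small_elements le C T \<subseteq> small_elements le C S"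
    using Fb D(6)[OF S] TS by (auto simp: small_elements_def)
  then have "\<forall>s\<in>T. \<forall>i. \<not> {s, s + axis i 1} \<subseteq> small_elements le C T"
    using SA TS unfolding A_semigroups_def A_semigroup_def by blast
  ultimately show ?thesis
    using Fb by (simp add: A_semigroups_def A_semigroup_def T_def)
qed

theorem proposition8:
  fixes C :: "(nat ^ 'p) set"
    and le :: "nat ^ 'p \<Rightarrow> nat ^ 'p \<Rightarrow> bool" (infix "\<preceq>" 50)
    and f :: "nat ^ 'p"
    and X :: "(nat ^ 'p) set"
  assumes "integer_cone C"
    and "card (cone_rays C) \<ge> CARD('p)"
    and "monomial_order (\<preceq>)"
    and "\<forall>k\<in>C. finite {x \<in> C. x \<preceq> k}"
    and "f \<in> C - {0}"
    and "A_set (\<preceq>) C f X"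
  shows "A_generated (\<preceq>) C f X \<in> A_semigroups (\<preceq>) C f \<and>
         X \<subseteq> A_generated (\<preceq>) C f X \<and>
         (\<forall>S\<in>A_semigroups (\<preceq>) C f. X \<subseteq> S \<longrightarrow> A_generated (\<preceq>) C f X \<subseteq> S)"
proof -
  have "finite {x \<in> C. x \<preceq> f}" using assms(4,5) by blast
  moreover have "{S \<in> A_semigroups (\<preceq>) C f. X \<subseteq> S} \<noteq> {}"
    using assms(6) by (auto simp: A_set_def)
  ultimately have "A_generated (\<preceq>) C f X \<in> A_semigroups (\<preceq>) C f"
    unfolding A_generated_def using assms(1,3) by (intro Inter_A_semigroups) auto
  then show ?thesis by (auto simp: A_generated_def)
qed

end
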